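(* For any $\delta>0$ and any $\tau>0$, any statistical algorithm requires at least $\tau^2(2^n-1)$ queries to $\mathrm{STAT}(\tau)$ to solve $\left(\frac12-\delta\right)$-approximate MAX-XOR-SAT on $n$ variables. In particular, at least $2^{n/3}$ queries of tolerance $2^{-n/3}$ are required.
   Context: An XOR clause on $n$ variables (without negations) is a vector $c\in\{0,1\}^n$, where $c_i=1$ means variable $i$ appears; an assignment $x\in\{0,1\}^n$ satisfies $c$ iff $\sum_i c_ix_i$ is odd. For $\epsilon\ge0$, the $\epsilon$-approximate MAX-XOR-SAT problem: given access to an unknown distribution $D$ over clauses (any distribution over $\{0,1\}^n$), find an assignment $x$ such that $\Pr_{c\sim D}[x\text{ satisfies }c]\ge\max_{y\in\{0,1\}^n}\Pr_{c\sim D}[y\text{ satisfies }c]-\epsilon$. A statistical algorithm accesses $D$ only by adaptively submitting queries to the oracle $\mathrm{STAT}(\tau)$, which, given $h:\{0,1\}^n\to[-1,1]$, returns any $v$ with $|v-\mathbb{E}_{c\sim D}[h(c)]|\le\tau$; it solves the problem if for every $D$ and every sequence of answers permitted by the oracle, its output is a valid solution.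
   Formalization: The formal theorem assumes n ≥ 2: for n = 1 the assignment x = 1 is optimal for every D, so no queries are needed and both bounds fail; for n = 0 the first bound is trivially 0 and the second fails. *)

theory Defs
  imports "HOL-Probability.Probability"
begin

text \<open>
  A clause, and likewise an assignment, on \<open>n\<close> variables is an element of \<open>{0,1}\<^sup>n\<close>, represented
  by \<^typ>\<open>bool ^ 'n\<close> where \<open>n\<close> is the cardinality of the finite index type \<open>'n\<close>.
\<close>

type_synonym 'n cube = "bool ^ 'n"

definition satisfies :: "'n::finite cube \<Rightarrow> 'n cube \<Rightarrow> bool" where
  "satisfies x c \<longleftrightarrow> odd (\<Sum>i\<in>UNIV. of_bool (c $ i) * of_bool (x $ i) :: nat)"

definition sat_prob :: "'n::finite cube pmf \<Rightarrow> 'n cube \<Rightarrow> real" where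
  "sat_prob D x = measure_pmf.prob D {c. satisfies x c}"

definition max_xor_sat_solution :: "real \<Rightarrow> 'n::finite cube pmf \<Rightarrow> 'n cube \<Rightarrow> bool" where
  "max_xor_sat_solution \<epsilon> D x \<longleftrightarrow> sat_prob D x \<ge> Max (range (sat_prob D)) - \<epsilon>"

definition STAT :: "real \<Rightarrow> 'n::finite cube pmf \<Rightarrow> ('n cube \<Rightarrow> real) \<Rightarrow> real set" where
  "STAT \<tau> D h = {v. \<bar>v - measure_pmf.expectation D h\<bar> \<le> \<tau>}"

text \<open>
  An adaptive algorithm chooses its next action from the list of oracle answers received so far
  (oldest first). Nothing is assumed about its computational resources.
\<close>

datatype 'n action = Query "'n cube \<Rightarrow> real" | Output "'n cube"

type_synonym 'n alg = "real list \<Rightarrow> 'n action"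

definition statistical_algorithm :: "'n::finite alg \<Rightarrow> bool" where
  "statistical_algorithm A \<longleftrightarrow> (\<forall>vs h. A vs = Query h \<longrightarrow> range h \<subseteq> {-1..1})"

text \<open>
  An answer sequence is an infinite stream \<open>v\<close>; answers beyond the point where the algorithm
  has produced an output are never read.
\<close>

definition permitted_answers ::
    "'n::finite alg \<Rightarrow> real \<Rightarrow> 'n cube pmf \<Rightarrow> (nat \<Rightarrow> real) \<Rightarrow> bool" where
  "permitted_answers A \<tau> D v \<longleftrightarrow>
     (\<forall>i h. A (map v [0..<i]) = Query h \<longrightarrow> v i \<in> STAT \<tau> D h)"

definition outputs_after :: "'n::finite alg \<Rightarrow> (nat \<Rightarrow> real) \<Rightarrow> nat \<Rightarrow> 'n cube \<Rightarrow> bool" where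
  "outputs_after A v k x \<longleftrightarrow>
     (\<forall>i<k. \<exists>h. A (map v [0..<i]) = Query h) \<and> A (map v [0..<k]) = Output x"

definition solves_max_xor_sat :: "'n::finite alg \<Rightarrow> real \<Rightarrow> real \<Rightarrow> bool" where
  "solves_max_xor_sat A \<tau> \<epsilon> \<longleftrightarrow>
     (\<forall>D v. permitted_answers A \<tau> D v \<longrightarrow>
        (\<exists>k x. outputs_after A v k x \<and> max_xor_sat_solution \<epsilon> D x))"

text \<open>
  Worst-case query count: on some distribution and some permitted answers, the algorithm makes
  at least \<open>N\<close> queries before producing its output.
\<close>

definition makes_at_least_queries :: "'n::finite alg \<Rightarrow> real \<Rightarrow> real \<Rightarrow> bool" where
  "makes_at_least_queries A \<tau> N \<longleftrightarrow>
     (\<exists>D v k x. permitted_answers A \<tau> D v \<and> outputs_after A v k x \<and> N \<le> real k)"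

end

theory Submission
  imports Defs
begin

text \<open>
  Write \<open>N = 2\<^sup>n\<close>, let \<open>\<chi>\<^sub>y\<close> be the Walsh characters of the cube, and for \<open>y \<noteq> 0\<close> and \<open>s = \<plusminus>1\<close> consider
  the distribution with density \<open>(1 + s \<chi>\<^sub>y) / N\<close>. A query \<open>h\<close> distinguishes it from the uniform one
  only by \<open>s\<close> times the Fourier coefficient of \<open>h\<close> at \<open>y\<close>. Answer every query as for the uniform
  distribution and let \<open>x\<close> be the output after \<open>k\<close> queries. If some \<open>y \<noteq> 0\<close> had Fourier coefficient
  at most \<open>\<tau>\<close> in all \<open>k\<close> queries, these answers would be permitted for both signs: \<open>s = -1\<close> forces
  \<open>x = y\<close>, since every other assignment satisfies at most half of the clauses, whereas for \<open>s = 1\<close>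
  the assignment \<open>y\<close> satisfies no clause and some other one satisfies half of them. Hence all
  \<open>N - 1\<close> nonzero characters are detected by a query, and by Parseval each query detects at most
  \<open>1 / \<tau>\<^sup>2\<close> of them.

  For \<open>\<tau> = 2 powr (-n/3)\<close> this yields \<open>k\<^sup>3 \<ge> 2\<^sup>n - 2\<close>, and \<open>2\<^sup>n - 2\<close> and \<open>2\<^sup>n - 1\<close> are not cubes.
\<close>

section \<open>Walsh characters\<close>

definition walsh :: "'n::finite cube \<Rightarrow> 'n cube \<Rightarrow> real" where
  "walsh x c = (\<Prod>i\<in>UNIV. if c $ i \<and> x $ i then -1 else 1)"

lemma walsh_commute: "walsh x c = walsh c x"
  by (simp add: walsh_def conj_commute)

lemma walsh_eq: "walsh x c = (if satisfies x c then -1 else 1)"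
proof -
  have "walsh x c = (\<Prod>i\<in>UNIV. (-1) ^ (of_bool (c $ i) * of_bool (x $ i) :: nat))"
    unfolding walsh_def by (intro prod.cong) auto
  also have "\<dots> = (-1) ^ (\<Sum>i\<in>UNIV. of_bool (c $ i) * of_bool (x $ i) :: nat)"
    by (rule power_sum[symmetric])
  finally show ?thesis
    by (simp add: satisfies_def)
qed

lemma walsh_zero [simp]: "walsh (\<chi> i. False) c = 1"
  by (simp add: walsh_def)

lemma walsh_self [simp]: "walsh x c * walsh x c = 1"
  by (simp add: walsh_eq)

definition flip :: "'n::finite \<Rightarrow> 'n cube \<Rightarrow> 'n cube" where
  "flip j c = (\<chi> i. if i = j then \<not> c $ i else c $ i)"

lemma flip_flip [simp]: "flip j (flip j c) = c"
  by (simp add: flip_def vec_eq_iff)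

lemma walsh_flip: "walsh x (flip j c) = (if x $ j then - walsh x c else walsh x c)"
proof -
  have "(\<Prod>i\<in>UNIV - {j}. if flip j c $ i \<and> x $ i then -1 else 1 :: real)
      = (\<Prod>i\<in>UNIV - {j}. if c $ i \<and> x $ i then -1 else 1)"
    by (intro prod.cong) (auto simp: flip_def)
  then show ?thesis
    unfolding walsh_def by (subst (1 2 3) prod.remove[of UNIV j]) (auto simp: flip_def)
qed

text \<open>Flipping a coordinate where \<open>x\<close> and \<open>y\<close> differ permutes the
  cube and negates exactly one factor of every summand, so the sum equals its own negative.\<close>

lemma sum_walsh_mult:
  fixes x y :: "'n::finite cube"
  shows "(\<Sum>c\<in>UNIV. walsh x c * walsh y c) = (if x = y then 2 ^ CARD('n) else 0)"
proof (cases "x = y")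
  case True
  then show ?thesis by simp
next
  case False
  then obtain j where j: "x $ j \<noteq> y $ j"
    by (auto simp: vec_eq_iff)
  have "(\<Sum>c\<in>UNIV. walsh x c * walsh y c) = (\<Sum>c\<in>UNIV. walsh x (flip j c) * walsh y (flip j c))"
    by (rule sum.reindex_bij_witness[where i = "flip j" and j = "flip j"]) auto
  also have "\<dots> = - (\<Sum>c\<in>UNIV. walsh x c * walsh y c)"
    using j by (auto simp: walsh_flip sum_negf)
  finally show ?thesis
    using False by simp
qed

lemma sum_walsh:
  fixes x :: "'n::finite cube"
  shows "(\<Sum>c\<in>UNIV. walsh x c) = (if x = (\<chi> i. False) then 2 ^ CARD('n) else 0)"
  using sum_walsh_mult[of x "\<chi> i. False"] by simp

definition fourier :: "('n::finite cube \<Rightarrow> real) \<Rightarrow> 'n cube \<Rightarrow> real" where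
  "fourier h y = (\<Sum>c\<in>UNIV. h c * walsh y c) / 2 ^ CARD('n)"

lemma parseval:
  fixes h :: "'n::finite cube \<Rightarrow> real"
  shows "(\<Sum>y\<in>UNIV. (fourier h y)\<^sup>2) = (\<Sum>c\<in>UNIV. (h c)\<^sup>2) / 2 ^ CARD('n)"
proof -
  have "(\<Sum>y\<in>UNIV. (\<Sum>c\<in>UNIV. h c * walsh y c)\<^sup>2)
      = (\<Sum>y\<in>UNIV. \<Sum>c\<in>UNIV. \<Sum>d\<in>UNIV. h c * h d * (walsh c y * walsh d y))"
    by (simp add: power2_eq_square sum_product walsh_commute mult_ac)
  \<comment> \<open>The symmetry of \<open>walsh\<close> lets \<open>y\<close> act as the argument;
    summing over it first leaves only the diagonal \<open>c = d\<close>.\<close>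
  also have "\<dots> = (\<Sum>c\<in>UNIV. \<Sum>d\<in>UNIV. \<Sum>y\<in>UNIV. h c * h d * (walsh c y * walsh d y))"
    by (subst sum.swap) (intro sum.cong refl sum.swap)
  also have "\<dots> = (\<Sum>c\<in>UNIV. \<Sum>d\<in>UNIV. if c = d then h c * h d * 2 ^ CARD('n) else 0)"
    by (intro sum.cong) (auto simp flip: sum_distrib_left simp: sum_walsh_mult)
  also have "\<dots> = (\<Sum>c\<in>UNIV. (h c)\<^sup>2) * 2 ^ CARD('n)"
    by (simp add: power2_eq_square sum_distrib_right)
  finally show ?thesis
    by (simp add: fourier_def power_divide power2_eq_square flip: sum_divide_distrib)
qed

lemma sum_fourier_squared_le_1:
  fixes h :: "'n::finite cube \<Rightarrow> real"
  assumes "range h \<subseteq> {-1..1}"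
  shows "(\<Sum>y\<in>UNIV. (fourier h y)\<^sup>2) \<le> 1"
proof -
  have "(h c)\<^sup>2 \<le> 1" for c
    using assms by (auto simp: abs_square_le_1 abs_le_iff image_subset_iff minus_le_iff)
  then have "(\<Sum>c\<in>UNIV. (h c)\<^sup>2) \<le> (\<Sum>c\<in>(UNIV :: 'n cube set). 1)"
    by (intro sum_mono)
  then show ?thesis
    by (simp add: parseval)
qed

section \<open>Biased clause distributions\<close>

text \<open>For nonzero \<open>y\<close>, sign -1 is uniform on the clauses that \<open>y\<close>
  satisfies, sign 1 on those it violates.\<close>

definition biased :: "real \<Rightarrow> 'n::finite cube \<Rightarrow> 'n cube pmf" where
  "biased s y = embed_pmf (\<lambda>c. (1 + s * walsh y c) / 2 ^ CARD('n))"

context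
  fixes s :: real and y :: "'n::finite cube"
  assumes s: "\<bar>s\<bar> \<le> 1" and y: "y \<noteq> (\<chi> i. False)"
begin

lemma pmf_biased: "pmf (biased s y) c = (1 + s * walsh y c) / 2 ^ CARD('n)"
  unfolding biased_def
proof (rule pmf_embed_pmf)
  show nonneg: "0 \<le> (1 + s * walsh y c) / 2 ^ CARD('n)" for c
    using s by (auto simp: walsh_eq)
  have "(\<Sum>c\<in>UNIV. (1 + s * walsh y c) / 2 ^ CARD('n)) = 1"
    using y by (simp add: sum.distrib sum_walsh flip: sum_divide_distrib sum_distrib_left)
  then show "(\<integral>\<^sup>+c. ennreal ((1 + s * walsh y c) / 2 ^ CARD('n)) \<partial>count_space UNIV) = 1"
    using nonneg by (simp add: nn_integral_count_space_finite)
qed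

lemma expectation_biased:
  "measure_pmf.expectation (biased s y) h = fourier h (\<chi> i. False) + s * fourier h y"
proof -
  have "measure_pmf.expectation (biased s y) h = (\<Sum>c\<in>UNIV. h c * pmf (biased s y) c)"
    by (rule integral_measure_pmf_real) auto
  also have "\<dots> = (\<Sum>c\<in>UNIV. h c / 2 ^ CARD('n) + s * (h c * walsh y c / 2 ^ CARD('n)))"
    by (intro sum.cong) (auto simp: pmf_biased field_simps)
  finally show ?thesis
    by (simp add: sum.distrib fourier_def sum_divide_distrib sum_distrib_left)
qed

text \<open>The indicator of satisfaction is \<open>(1 - walsh x c) / 2\<close>, whose spectrum lies
  on 0 and \<open>x\<close>; the expectation reads it only at 0 and \<open>y\<close>.\<close>

lemma sat_prob_biased:
  "sat_prob (biased s y) x =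
     (if x = (\<chi> i. False) then 0 else if x = y then (1 - s) / 2 else 1 / 2)"
proof -
  let ?h = "\<lambda>c. (1 - walsh x c) / 2"
  have "sat_prob (biased s y) x = measure_pmf.expectation (biased s y) (indicator {c. satisfies x c})"
    by (simp add: sat_prob_def)
  also have "indicator {c. satisfies x c} = ?h"
    by (auto simp: fun_eq_iff walsh_eq indicator_def)
  finally have *: "sat_prob (biased s y) x = fourier ?h (\<chi> i. False) + s * fourier ?h y"
    by (simp only: expectation_biased)
  have "fourier ?h z = ((\<Sum>c\<in>UNIV. walsh z c) - (\<Sum>c\<in>UNIV. walsh x c * walsh z c)) / 2 / 2 ^ CARD('n)"
    for z
    by (simp add: fourier_def left_diff_distrib sum_subtractf flip: sum_divide_distrib)
  then have "fourier ?h z = ((if z = (\<chi> i. False) then 1 else 0) - (if x = z then 1 else 0)) / 2" for z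
    by (simp add: sum_walsh sum_walsh_mult)
  with * y show ?thesis
    by (auto simp: field_simps)
qed

end

section \<open>The adversary\<close>

text \<open>Each answer may depend on the whole history, so the recursion builds the finite prefixes
  \<open>L i\<close>.\<close>

lemma ex_answer_stream: "\<exists>v. \<forall>i. v i = g i (map v [0..<i])"
proof -
  define L where "L = rec_nat [] (\<lambda>i vs. vs @ [g i vs])"
  have L: "L 0 = []" "L (Suc i) = L i @ [g i (L i)]" for i
    by (simp_all add: L_def)
  have "map (\<lambda>i. g i (L i)) [0..<i] = L i" for i
    by (induction i) (simp_all add: L)
  then show ?thesis
    by (intro exI[of _ "\<lambda>i. g i (L i)"]) simp
qed

text \<open>\<open>permitted_answers\<close> constrains the entire stream, but a run fixes only its
  first \<open>k\<close> answers; exact expectations continue it.\<close>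

lemma permitted_answers_extend:
  assumes "\<And>i h. i < k \<Longrightarrow> A (map w [0..<i]) = Query h \<Longrightarrow> w i \<in> STAT \<tau> D h" and "\<tau> \<ge> 0"
  shows "\<exists>v. permitted_answers A \<tau> D v \<and> (\<forall>i\<le>k. map v [0..<i] = map w [0..<i])"
proof -
  define g where "g i vs = (if i < k then w i else case A vs of
      Query h \<Rightarrow> measure_pmf.expectation D h | Output x \<Rightarrow> 0)" for i vs
  obtain v where v: "\<And>i. v i = g i (map v [0..<i])"
    using ex_answer_stream[of g] by blast
  have eq: "v i = w i" if "i < k" for i
    using v[of i] that by (simp add: g_def)
  have map_eq: "map v [0..<i] = map w [0..<i]" if "i \<le> k" for i
    using that eq by auto
  have "v i \<in> STAT \<tau> D h" if "A (map v [0..<i]) = Query h" for i h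
  proof (cases "i < k")
    case True
    then show ?thesis
      using assms(1)[of i h] that eq map_eq[of i] by simp
  next
    case False
    then show ?thesis
      using v[of i] that assms(2) by (simp add: g_def STAT_def)
  qed
  then show ?thesis
    using map_eq unfolding permitted_answers_def by blast
qed

lemma outputs_after_unique:
  assumes "outputs_after A v k x" and "outputs_after A v k' x'"
  shows "k = k'" and "x = x'"
proof -
  show "k = k'"
    using assms unfolding outputs_after_def
    by (metis action.distinct(1) linorder_neqE_nat)
  then show "x = x'"
    using assms by (simp add: outputs_after_def)
qed

text \<open>The output depends only on the \<open>k\<close> answers read, so it must be valid for
  every \<open>D\<close> that permits these.\<close>

lemma solution_of_answers:
  assumes "solves_max_xor_sat A \<tau> \<epsilon>" and "outputs_after A w k x" and "\<tau> \<ge> 0"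
    and "\<And>i h. i < k \<Longrightarrow> A (map w [0..<i]) = Query h \<Longrightarrow> w i \<in> STAT \<tau> D h"
  shows "max_xor_sat_solution \<epsilon> D x"
proof -
  have "\<exists>v. permitted_answers A \<tau> D v \<and> (\<forall>i\<le>k. map v [0..<i] = map w [0..<i])"
    by (rule permitted_answers_extend) (fact assms)+
  then obtain v where permitted: "permitted_answers A \<tau> D v"
    and eq: "\<forall>i\<le>k. map v [0..<i] = map w [0..<i]"
    by blast
  have "outputs_after A v k x"
    using assms(2) eq unfolding outputs_after_def by (metis le_refl less_imp_le)
  moreover obtain k' x' where "outputs_after A v k' x'" "max_xor_sat_solution \<epsilon> D x'"
    using assms(1) permitted unfolding solves_max_xor_sat_def by blast
  ultimately show ?thesis
    using outputs_after_unique(2)[of A v k x k' x'] by simp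
qed

lemma sat_prob_ge_of_solution:
  assumes "max_xor_sat_solution \<epsilon> D x"
  shows "sat_prob D x \<ge> sat_prob D z - \<epsilon>"
proof -
  have "sat_prob D z \<le> Max (range (sat_prob D))"
    by (rule Max_ge) auto
  then show ?thesis
    using assms unfolding max_xor_sat_solution_def by linarith
qed

lemma no_common_solution:
  fixes x y :: "'n::finite cube"
  assumes "CARD('n) \<ge> 2" and "\<delta> > 0" and y: "y \<noteq> (\<chi> i. False)"
    and odd: "max_xor_sat_solution (1/2 - \<delta>) (biased (-1) y) x"
    and even: "max_xor_sat_solution (1/2 - \<delta>) (biased 1 y) x"
  shows False
proof -
  have "x = y"
    using sat_prob_ge_of_solution[OF odd, of y] y \<open>\<delta> > 0\<close>
    by (auto simp: sat_prob_biased split: if_splits)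
  \<comment> \<open>For \<open>n = 1\<close> there would be no assignment besides 0 and
    \<open>y\<close>; two variables provide a third one, which satisfies half of the
    clauses.\<close>
  have "card {y, \<chi> i. False} < CARD('n cube)"
  proof -
    have "card {y, \<chi> i. False} < 2 ^ 2"
      by (simp add: card_insert_if)
    also have "\<dots> \<le> (2 ^ CARD('n) :: nat)"
      using assms(1) by (intro power_increasing) auto
    finally show ?thesis by simp
  qed
  then obtain z where "z \<notin> {y, \<chi> i. False}"
    by (metis UNIV_eq_I less_irrefl)
  then show False
    using sat_prob_ge_of_solution[OF even, of z] \<open>x = y\<close> y \<open>\<delta> > 0\<close>
    by (auto simp: sat_prob_biased)
qed

lemma makes_at_least_queries_bound:
  fixes A :: "'n::finite alg"
  assumes card: "CARD('n) \<ge> 2" and \<delta>: "\<delta> > 0" and \<tau>: "\<tau> > 0"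
    and A: "statistical_algorithm A" and solves: "solves_max_xor_sat A \<tau> (1/2 - \<delta>)"
  shows "makes_at_least_queries A \<tau> (\<tau>\<^sup>2 * (2 ^ CARD('n) - 1))"
proof -
  let ?z = "(\<chi> i. False) :: 'n cube"
  let ?u = "(\<chi> i. True) :: 'n cube"
  have u: "?u \<noteq> ?z"
    by (simp add: vec_eq_iff)
  \<comment> \<open>The bias 0 gives the uniform distribution, whatever the second argument.\<close>
  let ?U = "biased 0 ?u"
  \<comment> \<open>The Fourier coefficient at 0 is the exact mean of \<open>h\<close> under the
    uniform distribution.\<close>
  define g where "g i vs = (case A vs of Query h \<Rightarrow> fourier h ?z | Output x \<Rightarrow> 0)" for i :: nat and vs
  obtain w where w: "\<And>i. w i = g i (map w [0..<i])"
    using ex_answer_stream[of g] by blast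
  have w_Query: "w i = fourier h ?z" if "A (map w [0..<i]) = Query h" for i h
    using w[of i] that by (simp add: g_def)
  have permitted: "permitted_answers A \<tau> ?U w"
    using w_Query \<tau> u by (auto simp: permitted_answers_def STAT_def expectation_biased)
  then obtain k x where kx: "outputs_after A w k x"
    using solves unfolding solves_max_xor_sat_def by blast
  then obtain h where h: "\<And>i. i < k \<Longrightarrow> A (map w [0..<i]) = Query (h i)"
    unfolding outputs_after_def by metis
  have large: "\<exists>i<k. \<tau> < \<bar>fourier (h i) y\<bar>" if y: "y \<noteq> ?z" for y
  proof (rule ccontr)
    assume "\<not> (\<exists>i<k. \<tau> < \<bar>fourier (h i) y\<bar>)"
    then have small: "\<bar>fourier (h i) y\<bar> \<le> \<tau>" if "i < k" for i
      using that by (meson not_less)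
    \<comment> \<open>The answer is off by \<open>s * fourier h' y\<close>, which is within the
      tolerance for either sign.\<close>
    have "w i \<in> STAT \<tau> (biased s y) h'"
      if "\<bar>s\<bar> = 1" "i < k" "A (map w [0..<i]) = Query h'" for s i h'
      using that small[of i] h[of i] w_Query[of i h'] y
      by (simp add: STAT_def expectation_biased abs_mult)
    then have "max_xor_sat_solution (1/2 - \<delta>) (biased s y) x" if "\<bar>s\<bar> = 1" for s
      using that \<tau> by (intro solution_of_answers[OF solves kx]) auto
    then show False
      using no_common_solution[OF card \<delta> y, of x] by simp
  qed
  have detected: "\<tau>\<^sup>2 \<le> (\<Sum>i<k. (fourier (h i) y)\<^sup>2)" if "y \<noteq> ?z" for y
  proof -
    obtain i where i: "i < k" "\<tau> < \<bar>fourier (h i) y\<bar>"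
      using large \<open>y \<noteq> ?z\<close> by blast
    then have "\<tau>\<^sup>2 \<le> (fourier (h i) y)\<^sup>2"
      using \<tau> power_mono[of \<tau> "\<bar>fourier (h i) y\<bar>" 2] by simp
    also have "\<dots> \<le> (\<Sum>i<k. (fourier (h i) y)\<^sup>2)"
      using i(1) by (intro member_le_sum) auto
    finally show ?thesis .
  qed
  \<comment> \<open>Double counting of the squared coefficients: each nonzero \<open>y\<close>
    collects at least \<open>\<tau>\<^sup>2\<close>, each query contributes at most 1.\<close>
  have "\<tau>\<^sup>2 * (2 ^ CARD('n) - 1) = (\<Sum>y\<in>UNIV - {?z}. \<tau>\<^sup>2)"
    by (simp add: card_Diff_singleton mult.commute)
  also have "\<dots> \<le> (\<Sum>y\<in>UNIV - {?z}. \<Sum>i<k. (fourier (h i) y)\<^sup>2)"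
    using detected by (intro sum_mono) auto
  also have "\<dots> \<le> (\<Sum>y\<in>UNIV. \<Sum>i<k. (fourier (h i) y)\<^sup>2)"
    by (intro sum_mono2) (auto intro: sum_nonneg)
  also have "\<dots> = (\<Sum>i<k. \<Sum>y\<in>UNIV. (fourier (h i) y)\<^sup>2)"
    by (rule sum.swap)
  also have "\<dots> \<le> (\<Sum>i<k. 1)"
    using A h unfolding statistical_algorithm_def
    by (intro sum_mono sum_fourier_squared_le_1) blast
  finally have "\<tau>\<^sup>2 * (2 ^ CARD('n) - 1) \<le> real k"
    by simp
  \<comment> \<open>The run on the uniform distribution is itself the witness for the query
    count.\<close>
  then show ?thesis
    using permitted kx unfolding makes_at_least_queries_def by blast
qed

section \<open>Rounding up to the cube root\<close>

lemma cube_neq_power2_minus: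
  fixes k n :: nat
  assumes "n \<ge> 2"
  shows "k ^ 3 + 1 \<noteq> 2 ^ n" and "k ^ 3 + 2 \<noteq> 2 ^ n"
proof -
  have four: "(4::nat) dvd 2 ^ n"
    using le_imp_power_dvd[OF assms, of "2::nat"] by simp
  show "k ^ 3 + 1 \<noteq> 2 ^ n"
  proof
    assume eq: "k ^ 3 + 1 = 2 ^ n"
    have "int k ^ 3 + 1 = 2 ^ n"
      using arg_cong[OF eq, of int] by simp
    moreover have "int k ^ 3 + 1 = ((int k)\<^sup>2 - int k + 1) * (int k + 1)"
      by (simp add: algebra_simps power2_eq_square power3_eq_cube)
    ultimately have "((int k)\<^sup>2 - int k + 1) dvd 2 ^ n"
      by (metis dvd_triv_left)
    \<comment> \<open>This factor is odd because \<open>k * (k - 1)\<close> is even.\<close>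
    moreover have "coprime ((int k)\<^sup>2 - int k + 1) (2 ^ n)"
      by simp
    ultimately have "is_unit ((int k)\<^sup>2 - int k + 1)"
      by (metis coprime_absorb_left)
    then have "\<bar>int k * (int k - 1) + 1\<bar> = 1"
      by (simp add: power2_eq_square right_diff_distrib)
    moreover have "int k * (int k - 1) \<ge> 0"
      by (cases k) auto
    ultimately have "int k * (int k - 1) = 0"
      by linarith
    then have "k = 0 \<or> k = 1"
      by auto
    then have "2 ^ n \<le> (2::nat)"
      using eq by auto
    with dvd_imp_le[OF four] show False
      by simp
  qed
  show "k ^ 3 + 2 \<noteq> 2 ^ n"
  proof
    assume eq: "k ^ 3 + 2 = 2 ^ n"
    have "even (k ^ 3 + 2)"
      using four unfolding eq by (meson dvd_trans even_numeral)
    then have "even k"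
      by simp
    then have "4 dvd k ^ 3"
      by (auto simp: power3_eq_cube elim!: evenE)
    then have "(4::nat) dvd 2"
      using four unfolding eq[symmetric] by (metis dvd_add_right_iff)
    then show False
      by simp
  qed
qed

text \<open>With \<open>t = 2 powr (n / 3)\<close> the hypothesis reads
  \<open>k \<ge> t - 1 / t^2\<close>. Cubing shows that an integer \<open>k < t\<close> has
  \<open>2^n - 3 < k^3 < 2^n\<close>, and neither remaining value is a cube.\<close>

lemma nat_ge_cube_root_power2:
  fixes k n :: nat
  assumes n: "n \<ge> 2" and k: "(2 powr (- real n / 3))\<^sup>2 * (2 ^ n - 1) \<le> real k"
  shows "2 powr (real n / 3) \<le> real k"
proof (rule ccontr)
  define t where "t = 2 powr (real n / 3)"
  assume "\<not> 2 powr (real n / 3) \<le> real k"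
  then have "real k < t"
    by (simp add: t_def)
  have t: "t > 0" "t ^ 3 = 2 ^ n"
    by (simp_all add: t_def powr_powr powr_realpow flip: powr_numeral powr_realpow)
  have "1 \<le> t ^ 3"
    by (simp add: t)
  then have "1 / t ^ 3 \<le> 1" "0 < 1 / t ^ 3"
    using t by auto
  have "2 powr (- real n / 3) = 1 / t"
    by (simp add: t_def powr_minus_divide)
  then have "(t ^ 3 - 1) / t\<^sup>2 \<le> real k"
    using k by (simp add: t power_divide)
  moreover have "0 \<le> (t ^ 3 - 1) / t\<^sup>2"
    using \<open>1 \<le> t ^ 3\<close> by simp
  ultimately have "((t ^ 3 - 1) / t\<^sup>2) ^ 3 \<le> real k ^ 3"
    by (intro power_mono)
  moreover have "((t ^ 3 - 1) / t\<^sup>2) ^ 3 = t ^ 3 - 3 + (3 - 1 / t ^ 3) * (1 / t ^ 3)"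
    using t(1) by (simp add: field_simps power2_eq_square power3_eq_cube)
  moreover have "0 < (3 - 1 / t ^ 3) * (1 / t ^ 3)"
    using \<open>1 / t ^ 3 \<le> 1\<close> \<open>0 < 1 / t ^ 3\<close> by (intro mult_pos_pos) linarith+
  ultimately have "2 ^ n < real k ^ 3 + 3"
    using t by linarith
  then have "real (2 ^ n) < real (k ^ 3 + 3)"
    by simp
  then have "2 ^ n < k ^ 3 + 3"
    by (simp only: of_nat_less_iff)
  moreover have "real k ^ 3 < t ^ 3"
    using \<open>real k < t\<close> by (intro power_strict_mono) auto
  then have "real (k ^ 3) < real (2 ^ n)"
    by (simp add: t)
  then have "k ^ 3 < 2 ^ n"
    by (simp only: of_nat_less_iff)
  ultimately show False
    using cube_neq_power2_minus[OF n, of k] by linarith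
qed

theorem theorem4p2:
  fixes \<delta> :: real
  assumes "CARD('n::finite) \<ge> 2" and "\<delta> > 0"
  shows "(\<forall>\<tau>>0. \<forall>A :: 'n alg.
            statistical_algorithm A \<and> solves_max_xor_sat A \<tau> (1/2 - \<delta>) \<longrightarrow>
            makes_at_least_queries A \<tau> (\<tau>\<^sup>2 * (2 ^ CARD('n) - 1))) \<and>
         (\<forall>A :: 'n alg.
            statistical_algorithm A \<and>
            solves_max_xor_sat A (2 powr (- real CARD('n) / 3)) (1/2 - \<delta>) \<longrightarrow>
            makes_at_least_queries A (2 powr (- real CARD('n) / 3)) (2 powr (real CARD('n) / 3)))"
proof (intro conjI allI impI; elim conjE)
  fix \<tau> :: real and A :: "'n alg"
  assume "\<tau> > 0" "statistical_algorithm A" "solves_max_xor_sat A \<tau> (1/2 - \<delta>)"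
  then show "makes_at_least_queries A \<tau> (\<tau>\<^sup>2 * (2 ^ CARD('n) - 1))"
    by (rule makes_at_least_queries_bound[OF assms])
next
  fix A :: "'n alg"
  let ?\<tau> = "2 powr (- real CARD('n) / 3)"
  assume "statistical_algorithm A" "solves_max_xor_sat A ?\<tau> (1/2 - \<delta>)"
  then have "makes_at_least_queries A ?\<tau> (?\<tau>\<^sup>2 * (2 ^ CARD('n) - 1))"
    by (intro makes_at_least_queries_bound[OF assms]) auto
  then show "makes_at_least_queries A ?\<tau> (2 powr (real CARD('n) / 3))"
    unfolding makes_at_least_queries_def using nat_ge_cube_root_power2[OF assms(1)] by blast
qed

end
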